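(* Let $(G,\cdot)$ and $(H,\circ)$ be two distinct loops, where $H$ is an alternative central square loop. (a) If $G$ is a central square LC-loop and there are bijections $A,B:G\to H$ such that the triple $(A,B,B)$ is an isotopism of $G$ upon $H$, then $H$ is a C-loop. (b) If $G$ is a central square RC-loop and there are bijections $A,B:G\to H$ such that the triple $(A,B,A)$ is an isotopism of $G$ upon $H$, then $H$ is a C-loop.
   Context: A loop $(L,\cdot)$ is an LC-loop if $(xx)(yz)=(x(xy))z$, an RC-loop if $(zy)(xx)=z((yx)x)$, and a C-loop if $x(y(yz))=((xy)y)z$, for all $x,y,z\in L$. It is left alternative if $x(xy)=x^2y$ for all $x,y$, right alternative if $(yx)x=yx^2$ for all $x,y$, and alternative if it is both. The left, right and middle nuclei are $N_\lambda(L)=\{a: (ax)y=a(xy)\ \forall x,y\}$, $N_\rho(L)=\{a: y(xa)=(yx)a\ \forall x,y\}$, $N_\mu(L)=\{a:(ya)x=y(ax)\ \forall x,y\}$; the nucleus is $N(L)=N_\lambda(L)\cap N_\rho(L)\cap N_\mu(L)$; the centrum is $C(L)=\{a: ax=xa\ \forall x\}$; the center is $Z(L)=N(L)\cap C(L)$. $L$ is a central square loop if $x^2\in Z(L)$ for all $x\in L$. Maps are written on the right. A triple $(U,V,W)$ of bijections $G\to H$ is an isotopism of $(G,\cdot)$ upon $(H,\circ)$ if $xU\circ yV=(x\cdot y)W$ for all $x,y\in G$. *)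

theory Defs
  imports "HOL-Algebra.Group"
begin

text \<open>Loops are carried by the HOL-Algebra record \<open>monoid\<close>, of which only the fields
  (carrier, multiplication, identity) are used; associativity is not assumed.\<close>

locale loop =
  fixes L (structure)
  assumes m_closed: "\<lbrakk>x \<in> carrier L; y \<in> carrier L\<rbrakk> \<Longrightarrow> x \<otimes> y \<in> carrier L"
    and one_closed: "\<one> \<in> carrier L"
    and l_one: "x \<in> carrier L \<Longrightarrow> \<one> \<otimes> x = x"
    and r_one: "x \<in> carrier L \<Longrightarrow> x \<otimes> \<one> = x"
    and ex1_right_factor:
      "\<lbrakk>a \<in> carrier L; b \<in> carrier L\<rbrakk> \<Longrightarrow> \<exists>!x. x \<in> carrier L \<and> a \<otimes> x = b"
    and ex1_left_factor:
      "\<lbrakk>a \<in> carrier L; b \<in> carrier L\<rbrakk> \<Longrightarrow> \<exists>!y. y \<in> carrier L \<and> y \<otimes> a = b"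

locale LC_loop = loop +
  assumes LC_identity:
    "\<lbrakk>x \<in> carrier L; y \<in> carrier L; z \<in> carrier L\<rbrakk>
      \<Longrightarrow> (x \<otimes> x) \<otimes> (y \<otimes> z) = (x \<otimes> (x \<otimes> y)) \<otimes> z"

locale RC_loop = loop +
  assumes RC_identity:
    "\<lbrakk>x \<in> carrier L; y \<in> carrier L; z \<in> carrier L\<rbrakk>
      \<Longrightarrow> (z \<otimes> y) \<otimes> (x \<otimes> x) = z \<otimes> ((y \<otimes> x) \<otimes> x)"

locale C_loop = loop +
  assumes C_identity:
    "\<lbrakk>x \<in> carrier L; y \<in> carrier L; z \<in> carrier L\<rbrakk>
      \<Longrightarrow> x \<otimes> (y \<otimes> (y \<otimes> z)) = ((x \<otimes> y) \<otimes> y) \<otimes> z"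

locale left_alternative_loop = loop +
  assumes left_alternative:
    "\<lbrakk>x \<in> carrier L; y \<in> carrier L\<rbrakk> \<Longrightarrow> x \<otimes> (x \<otimes> y) = (x \<otimes> x) \<otimes> y"

locale right_alternative_loop = loop +
  assumes right_alternative:
    "\<lbrakk>x \<in> carrier L; y \<in> carrier L\<rbrakk> \<Longrightarrow> (y \<otimes> x) \<otimes> x = y \<otimes> (x \<otimes> x)"

locale alternative_loop = left_alternative_loop + right_alternative_loop

definition left_nucleus :: "('a, 'm) monoid_scheme \<Rightarrow> 'a set" where
  "left_nucleus L = {a \<in> carrier L. \<forall>x \<in> carrier L. \<forall>y \<in> carrier L.
     (a \<otimes>\<^bsub>L\<^esub> x) \<otimes>\<^bsub>L\<^esub> y = a \<otimes>\<^bsub>L\<^esub> (x \<otimes>\<^bsub>L\<^esub> y)}"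

definition right_nucleus :: "('a, 'm) monoid_scheme \<Rightarrow> 'a set" where
  "right_nucleus L = {a \<in> carrier L. \<forall>x \<in> carrier L. \<forall>y \<in> carrier L.
     y \<otimes>\<^bsub>L\<^esub> (x \<otimes>\<^bsub>L\<^esub> a) = (y \<otimes>\<^bsub>L\<^esub> x) \<otimes>\<^bsub>L\<^esub> a}"

definition middle_nucleus :: "('a, 'm) monoid_scheme \<Rightarrow> 'a set" where
  "middle_nucleus L = {a \<in> carrier L. \<forall>x \<in> carrier L. \<forall>y \<in> carrier L.
     (y \<otimes>\<^bsub>L\<^esub> a) \<otimes>\<^bsub>L\<^esub> x = y \<otimes>\<^bsub>L\<^esub> (a \<otimes>\<^bsub>L\<^esub> x)}"

definition nucleus :: "('a, 'm) monoid_scheme \<Rightarrow> 'a set" where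
  "nucleus L = left_nucleus L \<inter> right_nucleus L \<inter> middle_nucleus L"

definition centrum :: "('a, 'm) monoid_scheme \<Rightarrow> 'a set" where
  "centrum L = {a \<in> carrier L. \<forall>x \<in> carrier L. a \<otimes>\<^bsub>L\<^esub> x = x \<otimes>\<^bsub>L\<^esub> a}"

definition loop_center :: "('a, 'm) monoid_scheme \<Rightarrow> 'a set" where
  "loop_center L = nucleus L \<inter> centrum L"

locale central_square_loop = loop +
  assumes square_central: "x \<in> carrier L \<Longrightarrow> x \<otimes> x \<in> loop_center L"

text \<open>Maps are applied on the left here: \<open>U x\<close> stands for the right-hand notation \<open>xU\<close>.\<close>

definition isotopism ::
  "('a, 'm) monoid_scheme \<Rightarrow> ('b, 'n) monoid_scheme \<Rightarrow>
    ('a \<Rightarrow> 'b) \<times> ('a \<Rightarrow> 'b) \<times> ('a \<Rightarrow> 'b) \<Rightarrow> bool" where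
  "isotopism G H = (\<lambda>(U, V, W).
     bij_betw U (carrier G) (carrier H) \<and>
     bij_betw V (carrier G) (carrier H) \<and>
     bij_betw W (carrier G) (carrier H) \<and>
     (\<forall>x \<in> carrier G. \<forall>y \<in> carrier G. U x \<otimes>\<^bsub>H\<^esub> V y = W (x \<otimes>\<^bsub>G\<^esub> y)))"

end

theory Submission
  imports Defs
begin

text \<open>Alternativity on either side replaces the repeated factor \<open>y\<close> in
  \<open>x(y(yz)) = ((xy)y)z\<close> by its square, so that the C-identity becomes
  \<open>x(y\<^sup>2z) = (xy\<^sup>2)z\<close>: every square lies in the middle nucleus.
  Squares of \<open>H\<close> are central, hence in the middle nucleus, and both parts follow from
  \<open>C_loop_if_squares_middle_nuclear\<close> applied to \<open>H\<close>.\<close>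

lemma C_loop_if_squares_middle_nuclear:
  fixes L (structure)
  assumes alt: "alternative_loop L"
    and sq: "\<And>y. y \<in> carrier L \<Longrightarrow> y \<otimes> y \<in> middle_nucleus L"
  shows "C_loop L"
proof -
  interpret alternative_loop L by (fact alt)
  show ?thesis
  proof
    fix x y z
    assume x: "x \<in> carrier L" and y: "y \<in> carrier L" and z: "z \<in> carrier L"
    have "x \<otimes> (y \<otimes> (y \<otimes> z)) = x \<otimes> ((y \<otimes> y) \<otimes> z)"
      using y z by (simp add: left_alternative)
    also have "\<dots> = (x \<otimes> (y \<otimes> y)) \<otimes> z"
      using sq[OF y] x z by (simp add: middle_nucleus_def)
    also have "\<dots> = ((x \<otimes> y) \<otimes> y) \<otimes> z"
      using x y by (simp add: right_alternative)
    finally show "x \<otimes> (y \<otimes> (y \<otimes> z)) = ((x \<otimes> y) \<otimes> y) \<otimes> z" .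
  qed
qed

theorem theorem4p3:
  fixes G :: "('a, 'm) monoid_scheme" and H :: "('b, 'n) monoid_scheme"
  assumes "loop G" and "loop H"
    and "alternative_loop H" and "central_square_loop H"
  shows "(central_square_loop G \<and> LC_loop G \<and>
            (\<exists>A B :: 'a \<Rightarrow> 'b. isotopism G H (A, B, B)) \<longrightarrow> C_loop H) \<and>
         (central_square_loop G \<and> RC_loop G \<and>
            (\<exists>A B :: 'a \<Rightarrow> 'b. isotopism G H (A, B, A)) \<longrightarrow> C_loop H)"
proof -
  have "y \<otimes>\<^bsub>H\<^esub> y \<in> middle_nucleus H" if "y \<in> carrier H" for y
    using central_square_loop.square_central[OF assms(4) that]
    by (simp add: loop_center_def nucleus_def)
  then have "C_loop H"
    by (rule C_loop_if_squares_middle_nuclear[OF assms(3)])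
  then show ?thesis by simp
qed

end
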